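(* Let $f_n$ denote the spanning tree polynomial of the complete graph $K_n$, and let $L(f_n)$ denote the minimum size of a monotone arithmetic $(+,\times)$ circuit computing $f_n$. Then \[ L(f_n)=2^{\Omega(\sqrt{n})}, \] that is, there exist a constant $c>0$ and an integer $n_0$ such that $L(f_n)\ge 2^{c\sqrt{n}}$ for all $n\ge n_0$.
   Context: $K_n$ is the complete undirected graph on $[n]=\{1,\ldots,n\}$. Each edge $e$ of $K_n$ has an associated formal variable $x_e$ (the graph is undirected, so $x_{\{i,j\}}$ is a single variable). $\mathcal{T}_n$ is the family of all spanning trees $T$ of $K_n$, each viewed as its set of $n-1$ edges. The spanning tree polynomial is \[ f_n(x)=\sum_{T\in\mathcal{T}_n}\ \prod_{e\in T}x_e . \] A monotone arithmetic $(+,\times)$ circuit is a directed acyclic graph in which each input gate holds one of the variables or a nonnegative real number, and every other gate has fanin two and computes the sum or the product of its two inputs (no subtraction); it computes a polynomial in the natural way. Its size is the number of its (non-input) gates. For a polynomial $f$ with positive coefficients, $L(f)$ is the minimum size of a monotone arithmetic circuit computing $f$. *)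

theory Defs
  imports Complex_Main "HOL-Library.Poly_Mapping"
begin

text \<open>Formal polynomials with real coefficients: finitely supported maps from monomials
  (finitely supported exponent vectors) to coefficients. Their product is the convolution
  product of the library.\<close>

type_synonym 'v mpoly = "('v \<Rightarrow>\<^sub>0 nat) \<Rightarrow>\<^sub>0 real"

definition pvar :: "'v \<Rightarrow> 'v mpoly" where
  "pvar x = Poly_Mapping.single (Poly_Mapping.single x 1) 1"

definition pconst :: "real \<Rightarrow> 'v mpoly" where
  "pconst c = Poly_Mapping.single 0 c"

definition complete_edges :: "nat \<Rightarrow> nat set set" where
  "complete_edges n = {e. e \<subseteq> {1..n} \<and> card e = 2}"

definition adj :: "nat set set \<Rightarrow> (nat \<times> nat) set" where
  "adj T = {(u, v). {u, v} \<in> T}"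

definition connected_graph :: "nat set \<Rightarrow> nat set set \<Rightarrow> bool" where
  "connected_graph V T \<longleftrightarrow> V \<noteq> {} \<and> (\<forall>u\<in>V. \<forall>v\<in>V. (u, v) \<in> (adj T)\<^sup>*)"

definition is_cycle :: "nat set set \<Rightarrow> nat list \<Rightarrow> bool" where
  "is_cycle T vs \<longleftrightarrow> length vs \<ge> 3 \<and> distinct vs \<and>
     (\<forall>i<length vs. {vs ! i, vs ! (Suc i mod length vs)} \<in> T)"

text \<open>The notion of tree in the AFP entry \<open>Graph_Theory\<close> forbids directed cycles. It does not
  fit here: in a symmetric digraph every edge is already a directed cycle of length two.\<close>

definition is_tree :: "nat set \<Rightarrow> nat set set \<Rightarrow> bool" where
  "is_tree V T \<longleftrightarrow> connected_graph V T \<and> (\<nexists>vs. is_cycle T vs)"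

definition spanning_trees :: "nat \<Rightarrow> nat set set set" where
  "spanning_trees n = {T. T \<subseteq> complete_edges n \<and> is_tree {1..n} T}"

definition spanning_tree_poly :: "nat \<Rightarrow> nat set mpoly" where
  "spanning_tree_poly n = (\<Sum>T\<in>spanning_trees n. \<Prod>e\<in>T. pvar e)"

text \<open>Gates are named by natural numbers. The two inputs of a sum or product gate may be the
  same gate, and a gate may feed any number of other gates.\<close>

datatype 'v gate_label = Var 'v | Const real | Plus nat nat | Times nat nat

record 'v circuit =
  gates :: "nat set"
  label :: "nat \<Rightarrow> 'v gate_label"
  out :: nat

primrec inputs :: "'v gate_label \<Rightarrow> nat set" where
  "inputs (Var x) = {}"
| "inputs (Const c) = {}"
| "inputs (Plus g h) = {g, h}"
| "inputs (Times g h) = {g, h}"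

primrec label_ok :: "'v set \<Rightarrow> 'v gate_label \<Rightarrow> bool" where
  "label_ok X (Var x) \<longleftrightarrow> x \<in> X"
| "label_ok X (Const c) \<longleftrightarrow> c \<ge> 0"
| "label_ok X (Plus g h) \<longleftrightarrow> True"
| "label_ok X (Times g h) \<longleftrightarrow> True"

definition wires :: "'v circuit \<Rightarrow> (nat \<times> nat) set" where
  "wires C = {(g, h). h \<in> gates C \<and> g \<in> inputs (label C h)}"

definition monotone_circuit :: "'v set \<Rightarrow> 'v circuit \<Rightarrow> bool" where
  "monotone_circuit X C \<longleftrightarrow> finite (gates C) \<and> out C \<in> gates C \<and>
     (\<forall>g\<in>gates C. label_ok X (label C g) \<and> inputs (label C g) \<subseteq> gates C) \<and>
     acyclic (wires C)"

inductive gate_poly :: "'v circuit \<Rightarrow> nat \<Rightarrow> 'v mpoly \<Rightarrow> bool" for C where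
  "label C g = Var x \<Longrightarrow> gate_poly C g (pvar x)"
| "label C g = Const c \<Longrightarrow> gate_poly C g (pconst c)"
| "label C g = Plus h k \<Longrightarrow> gate_poly C h p \<Longrightarrow> gate_poly C k q \<Longrightarrow> gate_poly C g (p + q)"
| "label C g = Times h k \<Longrightarrow> gate_poly C h p \<Longrightarrow> gate_poly C k q \<Longrightarrow> gate_poly C g (p * q)"

lemma gate_poly_unique:
  assumes "gate_poly C g p" and "gate_poly C g q"
  shows "p = q"
  using assms
proof (induction arbitrary: q)
  case (1 g x)
  from this(2) show ?case using 1(1) by cases auto
next
  case (2 g c)
  from this(2) show ?case using 2(1) by cases auto
next
  case (3 g h k p q r)
  from this(6) show ?case using 3(1,4,5) by cases auto
next
  case (4 g h k p q r)
  from this(6) show ?case using 4(1,4,5) by cases auto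
qed

lemma gate_poly_exists:
  assumes C: "monotone_circuit X C" and g: "g \<in> gates C"
  shows "\<exists>p. gate_poly C g p"
proof -
  have fin: "finite (gates C)" and
    closed: "\<And>h. h \<in> gates C \<Longrightarrow> inputs (label C h) \<subseteq> gates C"
    using C by (auto simp: monotone_circuit_def)
  have "wires C \<subseteq> gates C \<times> gates C"
    using closed by (auto simp: wires_def)
  then have "finite (wires C)"
    using fin by (meson finite_SigmaI finite_subset)
  then have "wf (wires C)"
    using C by (auto simp: monotone_circuit_def intro: finite_acyclic_wf)
  then show ?thesis using g
  proof (induction g rule: wf_induct_rule)
    case (less g)
    have IH: "\<exists>p. gate_poly C h p" if "h \<in> inputs (label C g)" for h
      using less closed that by (auto simp: wires_def)
    show ?case
      proof (cases "label C g")
      case (Plus h k)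
      with IH obtain p q where "gate_poly C h p" "gate_poly C k q" by fastforce
      with Plus show ?thesis by (blast intro: gate_poly.intros)
    next
      case (Times h k)
      with IH obtain p q where "gate_poly C h p" "gate_poly C k q" by fastforce
      with Times show ?thesis by (blast intro: gate_poly.intros)
    qed (blast intro: gate_poly.intros)+
  qed
qed

definition computes :: "'v circuit \<Rightarrow> 'v mpoly \<Rightarrow> bool" where
  "computes C f \<longleftrightarrow> gate_poly C (out C) f"

definition circuit_size :: "'v circuit \<Rightarrow> nat" where
  "circuit_size C = card {g \<in> gates C. inputs (label C g) \<noteq> {}}"

text \<open>The minimum size of a monotone circuit over the variables \<open>X\<close> that computes \<open>f\<close>. If there
  is no such circuit, the value is \<open>Inf {} = 0\<close>.\<close>

definition monotone_complexity :: "'v set \<Rightarrow> 'v mpoly \<Rightarrow> nat" where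
  "monotone_complexity X f = Inf {circuit_size C | C. monotone_circuit X C \<and> computes C f}"

end

theory Submission
  imports Defs "HOL-Library.FuncSet" "HOL-Real_Asymp.Real_Asymp"
begin

text \<open>A gate of the circuit contributes a rectangle: a set of factors \<open>a\<close> and cofactors \<open>b\<close> such that every
  \<open>a + b\<close> is the monomial of a spanning tree. The edges occurring in the factors (red, \<open>R\<close>) and in the
  cofactors (blue, \<open>B\<close>) are disjoint, and a tree of the rectangle has no two edges of one colour whose
  closing edge has the other colour, since exchanging a factor or cofactor would then create a
  triangle. Choosing the gate by descent, one can prescribe that the rectangle splits a given
  set of edges of the tree in a balanced way.

  Consider random spanning trees with root \<open>n\<close>, in which \<open>3m\<close> random pairs \<open>{x, y}\<close> are attached to the
  root by two of the three edges of the triangle \<open>{n, x, y}\<close>, and all other vertices, among them \<open>3m\<close>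
  random singles, by one edge. If the edges of the singles are split in a balanced way, then some cyclic
  matching of pairs with singles has at least \<open>m\<close> groups \<open>{n, x, y, z}\<close> that are not
  monochromatic complete graphs. Rerandomising each such group (which vertex is single, which edge of
  the triangle is omitted; nine ways) violates the colour condition in at least one way. So a
  rectangle covers at most a fraction \<open>3m (8/9)^m\<close> of the trees.\<close>

section \<open>Counting trees compatible with a colouring\<close>

definition cherry_ok :: "'e set \<Rightarrow> 'e set \<Rightarrow> 'e \<Rightarrow> 'e \<Rightarrow> 'e \<Rightarrow> bool" where
  "cherry_ok R B e f h \<longleftrightarrow> e \<in> R \<union> B \<and> f \<in> R \<union> B \<and>
     \<not> (e \<in> R \<and> f \<in> R \<and> h \<in> B) \<and> \<not> (e \<in> B \<and> f \<in> B \<and> h \<in> R)"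

text \<open>The choice \<open>c\<close> selects which of the three edges of the triangle \<open>r, x, y\<close> is omitted from the tree.\<close>

definition pair_ok :: "'a set set \<Rightarrow> 'a set set \<Rightarrow> 'a \<Rightarrow> 'a \<Rightarrow> 'a \<Rightarrow> nat \<Rightarrow> bool" where
  "pair_ok R B r x y c \<longleftrightarrow>
     (if c = 0 then cherry_ok R B {r, x} {x, y} {r, y}
      else if c = 1 then cherry_ok R B {r, y} {x, y} {r, x}
      else cherry_ok R B {r, x} {r, y} {x, y})"

definition K4 :: "'a \<Rightarrow> 'a \<Rightarrow> 'a \<Rightarrow> 'a \<Rightarrow> 'a set set" where
  "K4 r x y z = {{r, x}, {r, y}, {r, z}, {x, y}, {y, z}, {x, z}}"

definition nonmono :: "'a set set \<Rightarrow> 'a set set \<Rightarrow> 'a \<Rightarrow> 'a \<Rightarrow> 'a \<Rightarrow> 'a \<Rightarrow> bool" where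
  "nonmono R B r x y z \<longleftrightarrow> \<not> K4 r x y z \<subseteq> R \<and> \<not> K4 r x y z \<subseteq> B"

lemma nonmonoI:
  assumes "R \<inter> B = {}" "K4 r x y z \<inter> R \<noteq> {}" "K4 r x y z \<inter> B \<noteq> {}"
  shows "nonmono R B r x y z"
  using assms unfolding nonmono_def by blast

lemma pair_ok_triangle:
  assumes "R \<inter> B = {}" "pair_ok R B r x y 0" "pair_ok R B r x y 1" "pair_ok R B r x y 2"
  shows "{{r, x}, {r, y}, {x, y}} \<subseteq> R \<or> {{r, x}, {r, y}, {x, y}} \<subseteq> B"
  using assms by (auto simp: pair_ok_def cherry_ok_def)

lemma mono_K4:
  assumes RB: "R \<inter> B = {}"
    and "\<And>c. c < 3 \<Longrightarrow> pair_ok R B r x y c"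
    and "\<And>c. c < 3 \<Longrightarrow> pair_ok R B r y z c"
    and "\<And>c. c < 3 \<Longrightarrow> pair_ok R B r z x c"
  shows "\<not> nonmono R B r x y z"
proof -
  have "{{r, x}, {r, y}, {x, y}} \<subseteq> R \<or> {{r, x}, {r, y}, {x, y}} \<subseteq> B"
    "{{r, y}, {r, z}, {y, z}} \<subseteq> R \<or> {{r, y}, {r, z}, {y, z}} \<subseteq> B"
    "{{r, z}, {r, x}, {z, x}} \<subseteq> R \<or> {{r, z}, {r, x}, {z, x}} \<subseteq> B"
    by (rule pair_ok_triangle[OF RB]; simp add: assms)+
  then show ?thesis
    using RB by (auto simp: nonmono_def K4_def insert_commute)
qed

abbreviation positions :: "nat \<Rightarrow> (nat \<times> nat) set" where
  "positions k \<equiv> {..<k} \<times> {..<3}"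

definition placements :: "nat \<Rightarrow> 'a set \<Rightarrow> (nat \<times> nat \<Rightarrow> 'a) set" where
  "placements k V = {q \<in> positions k \<rightarrow>\<^sub>E V. inj_on q (positions k)}"

definition choices :: "nat \<Rightarrow> (nat \<Rightarrow> nat) set" where
  "choices k = {..<k} \<rightarrow>\<^sub>E {..<3}"

definition all_ok :: "'a set set \<Rightarrow> 'a set set \<Rightarrow> 'a \<Rightarrow> nat \<Rightarrow> (nat \<times> nat \<Rightarrow> 'a) \<Rightarrow> (nat \<Rightarrow> nat) \<Rightarrow> bool"
  where
  "all_ok R B r k q c \<longleftrightarrow>
     (\<forall>i<k. pair_ok R B r (q (i, 0)) (q (i, 1)) (c i) \<and> {r, q (i, 2)} \<in> R \<union> B)"

definition nonmono_groups :: "'a set set \<Rightarrow> 'a set set \<Rightarrow> 'a \<Rightarrow> nat \<Rightarrow> (nat \<times> nat \<Rightarrow> 'a) \<Rightarrow> nat set"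
  where
  "nonmono_groups R B r k q = {i\<in>{..<k}. nonmono R B r (q (i, 0)) (q (i, 1)) (q (i, 2))}"

text \<open>Position \<open>(i, 0)\<close> and \<open>(i, 1)\<close> form the \<open>i\<close>-th pair, \<open>(i, 2)\<close> is the \<open>i\<close>-th single vertex. The map
  \<open>g\<close> rotates the \<open>i\<close>-th group by \<open>fst (g i)\<close> and its choice by \<open>snd (g i)\<close>.\<close>

definition rotate_group :: "nat \<Rightarrow> (nat \<Rightarrow> nat \<times> nat) \<Rightarrow> nat \<times> nat \<Rightarrow> nat \<times> nat" where
  "rotate_group k g = (\<lambda>(i, j). if i < k \<and> j < 3 then (i, (j + fst (g i)) mod 3) else (i, j))"

definition shift_choice :: "nat \<Rightarrow> (nat \<Rightarrow> nat \<times> nat) \<Rightarrow> (nat \<Rightarrow> nat) \<Rightarrow> nat \<Rightarrow> nat" where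
  "shift_choice k g c = (\<lambda>i\<in>{..<k}. (c i + snd (g i)) mod 3)"

definition shift_single :: "nat \<Rightarrow> nat \<Rightarrow> nat \<times> nat \<Rightarrow> nat \<times> nat" where
  "shift_single k s = (\<lambda>(i, j). if i < k \<and> j = 2 then ((i + s) mod k, j) else (i, j))"

lemma finite_placements: "finite V \<Longrightarrow> finite (placements k V)"
  unfolding placements_def by (simp add: finite_PiE)

lemma finite_choices: "finite (choices k)"
  unfolding choices_def by (simp add: finite_PiE)

lemma add_mod_inj:
  fixes a b c k :: nat
  assumes "(a + c) mod k = (b + c) mod k" "a < k" "b < k"
  shows "a = b"
proof -
  have le: "y \<le> x" if "(x + c) mod k = (y + c) mod k" "x < k" "y < k" for x y
  proof (rule ccontr)
    assume "\<not> ?thesis"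
    then have "x + c \<le> y + c" "0 < y - x" "y - x < k" using that(3) by linarith+
    with that(1) have "k dvd (y + c) - (x + c)"
      by (metis mod_eq_dvd_iff_nat)
    then have "k dvd y - x" by (simp only: diff_cancel2)
    with \<open>0 < y - x\<close> \<open>y - x < k\<close> show False using nat_dvd_not_less by blast
  qed
  show ?thesis using le[of a b] le[of b a] assms by simp
qed

lemma placement_comp:
  assumes q: "q \<in> placements k V"
    and maps: "\<And>x. x \<in> positions k \<Longrightarrow> f x \<in> positions k"
    and outside: "\<And>x. x \<notin> positions k \<Longrightarrow> f x = x"
    and inj: "inj_on f (positions k)"
  shows "q \<circ> f \<in> placements k V"
proof -
  have "f ` positions k \<subseteq> positions k" by (intro image_subsetI maps)
  moreover have "inj_on q (positions k)" using q by (simp add: placements_def)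
  ultimately have "inj_on (q \<circ> f) (positions k)"
    by (intro comp_inj_on[OF inj]) (rule inj_on_subset)
  moreover have q': "q \<in> positions k \<rightarrow>\<^sub>E V" using q by (simp add: placements_def)
  have "q \<circ> f \<in> positions k \<rightarrow>\<^sub>E V"
  proof (rule PiE_I)
    fix x assume "x \<in> positions k"
    then show "(q \<circ> f) x \<in> V"
      unfolding comp_apply by (intro PiE_mem[OF q'] maps)
  next
    fix x assume "x \<notin> positions k"
    then show "(q \<circ> f) x = undefined"
      unfolding comp_apply by (subst outside) (auto intro: PiE_arb[OF q'])
  qed
  ultimately show ?thesis by (simp add: placements_def)
qed

lemma placement_comp_inj:
  assumes "finite V"
    and maps: "\<And>x. x \<in> positions k \<Longrightarrow> f x \<in> positions k"
    and inj: "inj_on f (positions k)"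
  shows "inj_on (\<lambda>q. q \<circ> f) (placements k V)"
proof (rule inj_onI)
  fix q q' assume q: "q \<in> placements k V" "q' \<in> placements k V" and eq: "q \<circ> f = q' \<circ> f"
  have surj: "f ` positions k = positions k"
    by (intro endo_inj_surj inj image_subsetI maps) simp_all
  have "q x = q' x" if "x \<in> positions k" for x
  proof -
    obtain y where "x = f y" using \<open>x \<in> positions k\<close> surj by blast
    then show ?thesis using fun_cong[OF eq, of y] by simp
  qed
  then show "q = q'"
    using q by (intro PiE_ext[of q "positions k" "\<lambda>_. V" q']) (simp_all add: placements_def)
qed

lemma rotate_group_positions: "x \<in> positions k \<Longrightarrow> rotate_group k g x \<in> positions k"
  by (auto simp: rotate_group_def)

lemma rotate_group_inj: "inj_on (rotate_group k g) (positions k)"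
  by (auto simp: rotate_group_def inj_on_def dest: add_mod_inj)

lemma placement_rotate:
  assumes "q \<in> placements k V"
  shows "q \<circ> rotate_group k g \<in> placements k V"
  by (rule placement_comp[OF assms rotate_group_positions _ rotate_group_inj])
    (auto simp: rotate_group_def split: if_splits)

lemma shift_choice_choices: "shift_choice k g c \<in> choices k"
  unfolding choices_def shift_choice_def by (rule restrict_PiE_iff[THEN iffD2]) simp

lemma shift_choice_inj: "inj_on (shift_choice k g) (choices k)"
proof (rule inj_onI)
  fix c c' assume c: "c \<in> choices k" "c' \<in> choices k" and eq: "shift_choice k g c = shift_choice k g c'"
  have lt: "c i < 3" "c' i < 3" if "i < k" for i
    using PiE_mem[OF c(1)[unfolded choices_def], of i] PiE_mem[OF c(2)[unfolded choices_def], of i] that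
    by simp_all
  have "c i = c' i" if "i \<in> {..<k}" for i
  proof (rule add_mod_inj)
    show "(c i + snd (g i)) mod 3 = (c' i + snd (g i)) mod 3"
      using fun_cong[OF eq, of i] that by (simp add: shift_choice_def)
  qed (use lt that in simp_all)
  then show "c = c'"
    by (rule PiE_ext[OF c[unfolded choices_def]])
qed

lemma shift_single_positions: "x \<in> positions k \<Longrightarrow> shift_single k s x \<in> positions k"
  by (auto simp: shift_single_def)

lemma shift_single_inj: "inj_on (shift_single k s) (positions k)"
  by (auto simp: shift_single_def inj_on_def dest: add_mod_inj split: if_splits)

lemma averaging:
  fixes act :: "'g \<Rightarrow> 'w \<Rightarrow> 'w"
  assumes fin: "finite W" "finite G"
    and bij: "\<And>g. g \<in> G \<Longrightarrow> bij_betw (act g) W W"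
    and A: "A \<subseteq> W"
    and bound: "\<And>w. w \<in> W \<Longrightarrow> real (card {g\<in>G. act g w \<in> A}) \<le> b"
  shows "real (card G) * real (card A) \<le> real (card W) * b"
proof -
  have "card {w\<in>W. act g w \<in> A} = card A" if "g \<in> G" for g
  proof -
    have "act g ` {w\<in>W. act g w \<in> A} = A"
    proof (intro equalityI subsetI)
      fix x assume x: "x \<in> A"
      then have "x \<in> act g ` W" using A bij[OF that] by (auto simp: bij_betw_def)
      then show "x \<in> act g ` {w\<in>W. act g w \<in> A}" using x by blast
    qed blast
    moreover have "inj_on (act g) {w\<in>W. act g w \<in> A}"
      using bij[OF that] by (elim bij_betw_imp_inj_on[THEN inj_on_subset]) blast
    ultimately show ?thesis using card_image by fastforce
  qed
  then have "card G * card A = (\<Sum>g\<in>G. card {w\<in>W. act g w \<in> A})"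
    by simp
  also have "\<dots> = (\<Sum>w\<in>W. card {g\<in>G. act g w \<in> A})"
    using fin by (rule sum_multicount_gen[OF _ _ ballI[OF refl], rotated])
  finally have "real (card G * card A) = (\<Sum>w\<in>W. real (card {g\<in>G. act g w \<in> A}))"
    by simp
  also have "\<dots> \<le> (\<Sum>w\<in>W. b)" by (intro sum_mono bound)
  finally show ?thesis by simp
qed

lemma less3E: "(c::nat) < 3 \<Longrightarrow> (c = 0 \<Longrightarrow> P) \<Longrightarrow> (c = 1 \<Longrightarrow> P) \<Longrightarrow> (c = 2 \<Longrightarrow> P) \<Longrightarrow> P"
  by linarith

lemma nonmono_groups_rotate:
  assumes "g \<in> {..<k} \<rightarrow>\<^sub>E {..<3} \<times> {..<3}"
  shows "nonmono_groups R B r k (q \<circ> rotate_group k g) = nonmono_groups R B r k q"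
proof -
  have "K4 r (q (i, (0 + h) mod 3)) (q (i, (1 + h) mod 3)) (q (i, (2 + h) mod 3)) =
    K4 r (q (i, 0)) (q (i, 1)) (q (i, 2))" if "h < 3" for h i
    using that
  proof (elim less3E)
    assume "h = 1"
    moreover have "(0 + 1) mod 3 = (1::nat)" "(1 + 1) mod 3 = (2::nat)" "(2 + 1) mod 3 = (0::nat)" by simp_all
    ultimately show ?thesis by (simp only:) (auto simp: K4_def)
  next
    assume "h = 2"
    moreover have "(0 + 2) mod 3 = (2::nat)" "(1 + 2) mod 3 = (0::nat)" "(2 + 2) mod 3 = (1::nat)" by simp_all
    ultimately show ?thesis by (simp only:) (auto simp: K4_def)
  qed simp
  moreover have "fst (g i) < 3" if "i < k" for i
  proof -
    have "g i \<in> {..<3} \<times> {..<3}" using that by (intro PiE_mem[OF assms]) simp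
    then show ?thesis by (simp add: mem_Times_iff)
  qed
  ultimately have "nonmono R B r (q (i, (0 + fst (g i)) mod 3)) (q (i, (1 + fst (g i)) mod 3))
      (q (i, (2 + fst (g i)) mod 3)) \<longleftrightarrow> nonmono R B r (q (i, 0)) (q (i, 1)) (q (i, 2))"
    if "i < k" for i
    using that by (simp only: nonmono_def)
  then show ?thesis
    by (auto simp: nonmono_groups_def rotate_group_def)
qed

lemma card_all_ok_nonmono:
  fixes k :: nat
  assumes RB: "R \<inter> B = {}" and V: "finite V"
  defines "W \<equiv> placements k V \<times> choices k"
  shows "real (card {(q, c)\<in>W. all_ok R B r k q c \<and> m \<le> card (nonmono_groups R B r k q)})
    \<le> (8/9) ^ m * real (card W)"
proof -
  define G :: "(nat \<Rightarrow> nat \<times> nat) set" where "G = {..<k} \<rightarrow>\<^sub>E {..<3} \<times> {..<3}"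
  define act where "act g = map_prod (\<lambda>q :: nat \<times> nat \<Rightarrow> 'a. q \<circ> rotate_group k g) (shift_choice k g)" for g
  define A where "A = {(q, c)\<in>W. all_ok R B r k q c \<and> m \<le> card (nonmono_groups R B r k q)}"
  have finW: "finite W" using V by (simp add: W_def finite_placements finite_choices)
  have finG: "finite G" by (simp add: G_def finite_PiE)
  have cardG: "card G = 9 ^ k" by (simp add: G_def card_PiE)
  have bij: "bij_betw (act g) W W" for g
  proof -
    have "act g ` W \<subseteq> W"
      unfolding act_def W_def
      by (intro image_subsetI) (clarsimp simp: placement_rotate shift_choice_choices)
    moreover have "inj_on (act g) W"
      unfolding act_def W_def
      by (rule map_prod_inj_on[OF placement_comp_inj[OF V rotate_group_positions rotate_group_inj]
            shift_choice_inj])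
    ultimately show ?thesis
      using finW endo_inj_surj by (intro bij_betw_imageI)
  qed
  have bound: "real (card {g\<in>G. act g w \<in> A}) \<le> 9 ^ k * (8/9) ^ m" if "w \<in> W" for w
  proof -
    obtain q c where w: "w = (q, c)" by force
    define N where "N = nonmono_groups R B r k q"
    have act_A: "all_ok R B r k (q \<circ> rotate_group k g) (shift_choice k g c) \<and> m \<le> card N"
      if "g \<in> G" "act g w \<in> A" for g
      using that(2) nonmono_groups_rotate[OF that(1)[unfolded G_def], of R B r q]
      by (simp add: A_def act_def w N_def)
    show ?thesis
    proof (cases "m \<le> card N")
      case False
      then have "{g\<in>G. act g w \<in> A} = {}"
        using act_A by blast
      then have "card {g\<in>G. act g w \<in> A} = 0" by (simp only: card.empty)
      then show ?thesis by simp
    next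
      case True
      define S where "S i = {(h, t)\<in>{..<3} \<times> {..<3}.
        pair_ok R B r (q (i, h mod 3)) (q (i, Suc h mod 3)) ((c i + t) mod 3)}" for i
      have S9: "S i \<subseteq> {..<3} \<times> {..<3}" for i by (auto simp: S_def)
      have finS: "finite (S i)" for i by (rule finite_subset[OF S9]) auto
      have cardS9: "card (S i) \<le> 9" for i
        using card_mono[OF _ S9[of i]] by simp
      have cardS8: "card (S i) \<le> 8" if i: "i \<in> N" for i
      proof (rule ccontr)
        assume "\<not> ?thesis"
        then have "card (S i) = 9" using cardS9[of i] by simp
        then have all: "S i = {..<3} \<times> {..<3}"
          using S9[of i] by (intro card_subset_eq) auto
        have "pair_ok R B r (q (i, h mod 3)) (q (i, Suc h mod 3)) t" if "h < 3" "t < 3" for h t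
        proof -
          define t' where "t' = (t + 3 - c i mod 3) mod 3"
          have "(c i + t') mod 3 = t"
          proof -
            have "(c i + t') mod 3 = (c i mod 3 + (t + 3 - c i mod 3)) mod 3"
              unfolding t'_def by (metis mod_add_eq mod_mod_trivial)
            also have "c i mod 3 + (t + 3 - c i mod 3) = t + 3"
              using mod_less_divisor[of 3 "c i"] by linarith
            finally show ?thesis using that by simp
          qed
          moreover have "(h, t') \<in> S i" using all that by (auto simp: t'_def)
          ultimately show ?thesis using that by (simp add: S_def)
        qed
        note ok = this
        have "pair_ok R B r (q (i, 0)) (q (i, 1)) t" if "t < 3" for t
          using ok[of 0 t] that by simp
        moreover have "pair_ok R B r (q (i, 1)) (q (i, 2)) t" if "t < 3" for t
          using ok[of 1 t] that by (simp add: numeral_2_eq_2)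
        moreover have "pair_ok R B r (q (i, 2)) (q (i, 0)) t" if "t < 3" for t
          using ok[of 2 t] that by simp
        ultimately have "\<not> nonmono R B r (q (i, 0)) (q (i, 1)) (q (i, 2))"
          by (intro mono_K4[OF RB])
        then show False using i by (auto simp: N_def nonmono_groups_def)
      qed
      have "{g\<in>G. act g w \<in> A} \<subseteq> Pi\<^sub>E {..<k} S"
      proof
        fix g assume "g \<in> {g\<in>G. act g w \<in> A}"
        then have g: "g \<in> G" and "act g w \<in> A" by simp_all
        then have ok: "all_ok R B r k (q \<circ> rotate_group k g) (shift_choice k g c)"
          using act_A by blast
        have "g i \<in> S i" if "i < k" for i
        proof -
          obtain h t where ht: "g i = (h, t)" by (cases "g i")
          have "g i \<in> {..<3} \<times> {..<3}" using PiE_mem[OF g[unfolded G_def], of i] that by simp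
          moreover have "pair_ok R B r ((q \<circ> rotate_group k g) (i, 0)) ((q \<circ> rotate_group k g) (i, 1))
              (shift_choice k g c i)"
            using ok that by (simp add: all_ok_def)
          ultimately show ?thesis
            using that by (simp add: ht S_def rotate_group_def shift_choice_def)
        qed
        then show "g \<in> Pi\<^sub>E {..<k} S" using g by (simp add: G_def PiE_iff)
      qed
      then have "card {g\<in>G. act g w \<in> A} \<le> card (Pi\<^sub>E {..<k} S)"
        using finS by (intro card_mono finite_PiE) auto
      also have "\<dots> = (\<Prod>i<k. card (S i))" by (simp add: card_PiE)
      finally have "real (card {g\<in>G. act g w \<in> A}) \<le> (\<Prod>i<k. real (card (S i)))"
        by (simp only: of_nat_prod[symmetric] of_nat_le_iff)
      also have "\<dots> \<le> (\<Prod>i<k. 9 * (if i \<in> N then 8/9 else 1))"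
      proof (intro prod_mono conjI)
        fix i
        have "real (card (S i)) \<le> real 8" if "i \<in> N" using cardS8[OF that] by (simp only: of_nat_le_iff)
        moreover have "real (card (S i)) \<le> real 9" using cardS9[of i] by (simp only: of_nat_le_iff)
        ultimately show "real (card (S i)) \<le> 9 * (if i \<in> N then 8/9 else 1)" by simp
      qed simp
      also have "\<dots> = 9 ^ k * (8/9) ^ card N"
      proof -
        have "{..<k} \<inter> N = N" by (auto simp: N_def nonmono_groups_def)
        then show ?thesis by (simp add: prod.distrib prod.If_cases)
      qed
      also have "\<dots> \<le> 9 ^ k * (8/9) ^ m"
        using True by (intro mult_left_mono power_decreasing) auto
      finally show ?thesis .
    qed
  qed
  have "A \<subseteq> W" by (auto simp: A_def)
  from averaging[OF finW finG bij this bound]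
  have "real (card G) * real (card A) \<le> real (card W) * (9 ^ k * (8/9) ^ m)" .
  then show ?thesis
    by (simp add: cardG A_def mult.commute)
qed

lemma all_ok_shift:
  assumes "all_ok R B r k q c"
  shows "all_ok R B r k (q \<circ> shift_single k s) c"
  using assms by (auto simp: all_ok_def shift_single_def)

lemma card_all_ok_nonmono_shift:
  fixes k :: nat
  assumes RB: "R \<inter> B = {}" and V: "finite V"
  defines "W \<equiv> placements k V \<times> choices k"
  shows "real (card {(q, c)\<in>W. all_ok R B r k q c \<and>
      m \<le> card (nonmono_groups R B r k (q \<circ> shift_single k s))})
    \<le> (8/9) ^ m * real (card W)" (is "real (card ?A) \<le> _")
proof -
  let ?B = "{(q, c)\<in>W. all_ok R B r k q c \<and> m \<le> card (nonmono_groups R B r k q)}"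
  let ?f = "\<lambda>(q, c). (q \<circ> shift_single k s, c)"
  have fin: "finite W" using V by (simp add: W_def finite_placements finite_choices)
  have "inj_on (\<lambda>q. q \<circ> shift_single k s) (placements k V)"
    by (rule placement_comp_inj[OF V shift_single_positions shift_single_inj])
  then have "inj_on ?f ?A" by (auto simp: inj_on_def W_def)
  moreover have "q \<circ> shift_single k s \<in> placements k V" if "q \<in> placements k V" for q
    by (rule placement_comp[OF that shift_single_positions _ shift_single_inj])
      (auto simp: shift_single_def split: if_splits)
  then have "?f ` ?A \<subseteq> ?B" by (auto simp: W_def all_ok_shift)
  moreover have "finite ?B" by (rule finite_subset[OF _ fin]) auto
  ultimately have "card ?A \<le> card ?B" by (rule card_inj_on_le)
  then show ?thesis
    using card_all_ok_nonmono[OF RB V, of k r m] unfolding W_def by linarith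
qed

lemma exists_shift:
  fixes u v :: "nat \<Rightarrow> bool"
  assumes k: "k > 0"
    and v: "card {j\<in>{..<k}. v j} \<ge> m" "card {j\<in>{..<k}. \<not> v j} \<ge> m"
  shows "\<exists>s<k. m \<le> card {i\<in>{..<k}. u i \<noteq> v ((i + s) mod k)}"
proof (rule ccontr)
  assume "\<not> ?thesis"
  then have less: "card {i\<in>{..<k}. u i \<noteq> v ((i + s) mod k)} < m" if "s < k" for s
    using that by force
  have "k * m \<le> (\<Sum>i<k. card {j\<in>{..<k}. u i \<noteq> v j})"
  proof -
    have "m \<le> card {j\<in>{..<k}. u i \<noteq> v j}" for i using v by (cases "u i") auto
    then have "(\<Sum>i<k. m) \<le> (\<Sum>i<k. card {j\<in>{..<k}. u i \<noteq> v j})" by (intro sum_mono)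
    then show ?thesis by simp
  qed
  also have "\<dots> = (\<Sum>i<k. card {s\<in>{..<k}. u i \<noteq> v ((i + s) mod k)})"
  proof (rule sum.cong)
    fix i
    have inj: "inj_on (\<lambda>s. (i + s) mod k) {..<k}"
      by (auto simp: inj_on_def add.commute[of i] dest: add_mod_inj)
    moreover have "(\<lambda>s. (i + s) mod k) ` {..<k} = {..<k}"
      using k inj by (intro endo_inj_surj) auto
    then have "(\<lambda>s. (i + s) mod k) ` {s\<in>{..<k}. u i \<noteq> v ((i + s) mod k)} = {j\<in>{..<k}. u i \<noteq> v j}"
      by auto
    ultimately show "card {j\<in>{..<k}. u i \<noteq> v j} = card {s\<in>{..<k}. u i \<noteq> v ((i + s) mod k)}"
      by (metis (no_types, lifting) card_image inj_on_subset mem_Collect_eq subsetI)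
  qed simp
  also have "\<dots> = (\<Sum>s<k. card {i\<in>{..<k}. u i \<noteq> v ((i + s) mod k)})"
    by (intro sum_multicount_gen) auto
  also have "\<dots> < (\<Sum>s<k. m)"
    using less k by (intro sum_strict_mono) auto
  finally show False by simp
qed

definition balanced :: "'a set set \<Rightarrow> 'a set set \<Rightarrow> 'a \<Rightarrow> nat \<Rightarrow> nat \<Rightarrow> (nat \<times> nat \<Rightarrow> 'a) \<Rightarrow> bool" where
  "balanced R B r k m q \<longleftrightarrow> m \<le> card {j\<in>{..<k}. {r, q (j, 2)} \<in> R} \<and>
     m \<le> card {j\<in>{..<k}. {r, q (j, 2)} \<in> B}"

lemma card_all_ok_balanced:
  assumes RB: "R \<inter> B = {}" and V: "finite V" and k: "k > 0"
  defines "W \<equiv> placements k V \<times> choices k"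
  shows "real (card {(q, c)\<in>W. all_ok R B r k q c \<and> balanced R B r k m q})
    \<le> real k * (8/9) ^ m * real (card W)" (is "real (card ?A) \<le> _")
proof -
  define A where "A s = {(q, c)\<in>W. all_ok R B r k q c \<and>
      m \<le> card (nonmono_groups R B r k (q \<circ> shift_single k s))}" for s
  have fin: "finite W" using V by (simp add: W_def finite_placements finite_choices)
  have finA: "finite (A s)" for s unfolding A_def by (rule finite_subset[OF _ fin]) auto
  have "?A \<subseteq> (\<Union>s<k. A s)"
  proof clarify
    fix q c assume w: "(q, c) \<in> W" and ok: "all_ok R B r k q c" and bal: "balanced R B r k m q"
    define u where "u i \<longleftrightarrow> {{r, q (i, 0)}, {r, q (i, 1)}, {q (i, 0), q (i, 1)}} \<inter> R \<noteq> {}" for i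
    define v where "v j \<longleftrightarrow> {r, q (j, 2)} \<in> R" for j
    have "{j\<in>{..<k}. \<not> v j} = {j\<in>{..<k}. {r, q (j, 2)} \<in> B}"
      using ok RB unfolding v_def all_ok_def by blast
    then have "m \<le> card {j\<in>{..<k}. v j}" "m \<le> card {j\<in>{..<k}. \<not> v j}"
      using bal by (simp_all add: balanced_def v_def)
    from exists_shift[OF k this] obtain s
      where s: "s < k" "m \<le> card {i\<in>{..<k}. u i \<noteq> v ((i + s) mod k)}" by blast
    have "{i\<in>{..<k}. u i \<noteq> v ((i + s) mod k)} \<subseteq> nonmono_groups R B r k (q \<circ> shift_single k s)"
    proof clarify
      fix i assume i: "i < k" and uv: "u i \<noteq> v ((i + s) mod k)"
      have j: "(i + s) mod k < k" using k by simp
      have nu: "{{r, q (i, 0)}, {r, q (i, 1)}, {q (i, 0), q (i, 1)}} \<inter> B \<noteq> {}" if "\<not> u i"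
      proof -
        have "pair_ok R B r (q (i, 0)) (q (i, 1)) (c i)" using ok i by (simp add: all_ok_def)
        then show ?thesis using that by (simp add: u_def pair_ok_def cherry_ok_def split: if_splits)
      qed
      have nv: "{r, q (j, 2)} \<in> B" if "\<not> v j" "j < k" for j
        using ok that unfolding v_def all_ok_def by blast
      have "nonmono R B r (q (i, 0)) (q (i, 1)) (q ((i + s) mod k, 2))"
      proof (cases "u i")
        case True
        then have "{r, q ((i + s) mod k, 2)} \<in> B" using uv nv[OF _ j] by simp
        then show ?thesis using True unfolding u_def by (intro nonmonoI[OF RB]) (unfold K4_def, blast+)
      next
        case False
        then have "{r, q ((i + s) mod k, 2)} \<in> R" using uv by (simp add: v_def)
        then show ?thesis using nu[OF False] by (intro nonmonoI[OF RB]) (unfold K4_def, blast+)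
      qed
      then show "i \<in> nonmono_groups R B r k (q \<circ> shift_single k s)"
        using i by (simp add: nonmono_groups_def shift_single_def)
    qed
    then have "card {i\<in>{..<k}. u i \<noteq> v ((i + s) mod k)} \<le> card (nonmono_groups R B r k (q \<circ> shift_single k s))"
      by (intro card_mono) (simp_all add: nonmono_groups_def)
    with s(2) have "m \<le> card (nonmono_groups R B r k (q \<circ> shift_single k s))" by linarith
    then show "(q, c) \<in> (\<Union>s<k. A s)"
      using s(1) w ok by (simp add: A_def) blast
  qed
  then have "card ?A \<le> card (\<Union>s<k. A s)" using finA by (intro card_mono) auto
  also have "\<dots> \<le> (\<Sum>s<k. card (A s))" by (rule card_UN_le) simp
  finally have "real (card ?A) \<le> (\<Sum>s<k. real (card (A s)))"
    by (simp only: of_nat_sum[symmetric] of_nat_le_iff)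
  also have "\<dots> \<le> (\<Sum>s<k. (8/9) ^ m * real (card W))"
    unfolding A_def W_def by (intro sum_mono card_all_ok_nonmono_shift[OF RB V])
  finally show ?thesis by simp
qed

section \<open>Trees from parent functions\<close>

text \<open>A cycle would contain a vertex of maximal rank, and both of its neighbours on the cycle would
  have to be its parent.\<close>

lemma is_tree_parent:
  fixes rank par :: "nat \<Rightarrow> nat"
  assumes r: "r \<in> V"
    and par: "\<And>v. v \<in> V \<Longrightarrow> v \<noteq> r \<Longrightarrow> par v \<in> V \<and> rank (par v) < rank v"
  shows "is_tree V ((\<lambda>v. {v, par v}) ` (V - {r}))" (is "is_tree V ?T")
proof -
  have "(v, r) \<in> (adj ?T)\<^sup>*" if "v \<in> V" for v
    using that
  proof (induction "rank v" arbitrary: v rule: less_induct)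
    case less
    show ?case
    proof (cases "v = r")
      case False
      then have "(v, par v) \<in> adj ?T" using less.prems by (auto simp: adj_def)
      moreover have "(par v, r) \<in> (adj ?T)\<^sup>*" using less par False by blast
      ultimately show ?thesis by (rule converse_rtrancl_into_rtrancl)
    qed simp
  qed
  moreover have "sym ((adj ?T)\<^sup>*)"
    by (rule sym_rtrancl) (auto simp: sym_def adj_def insert_commute)
  ultimately have "(u, v) \<in> (adj ?T)\<^sup>*" if "u \<in> V" "v \<in> V" for u v
    using that by (meson rtrancl_trans symD)
  then have "connected_graph V ?T"
    using r by (auto simp: connected_graph_def)
  moreover have "\<not> is_cycle ?T vs" for vs
  proof
    assume "is_cycle ?T vs"
    then have len: "length vs \<ge> 3" and dist: "distinct vs"
      and edge: "\<And>i. i < length vs \<Longrightarrow> {vs ! i, vs ! (Suc i mod length vs)} \<in> ?T"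
      by (auto simp: is_cycle_def)
    define l where "l = length vs"
    obtain i where i: "i < l" and max: "\<And>j. j < l \<Longrightarrow> rank (vs ! j) \<le> rank (vs ! i)"
    proof -
      have ne: "{..<l} \<noteq> {}" using len by (auto simp: l_def lessThan_empty_iff)
      have "Max ((\<lambda>j. rank (vs ! j)) ` {..<l}) \<in> (\<lambda>j. rank (vs ! j)) ` {..<l}"
        using ne by (intro Max_in) auto
      then obtain i where "i < l" "rank (vs ! i) = Max ((\<lambda>j. rank (vs ! j)) ` {..<l})" by auto
      then show thesis using that[of i] by simp
    qed
    have parent: "w = par v" if "{v, w} \<in> ?T" "rank w \<le> rank v" for v w
    proof -
      from that(1) obtain u where u: "u \<in> V" "u \<noteq> r" "{v, w} = {u, par u}"
        by (elim imageE) blast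
      moreover have "rank (par u) < rank u" using par u by blast
      ultimately show ?thesis using that(2) by (auto simp: doubleton_eq_iff)
    qed
    define s where "s = Suc i mod l"
    define p where "p = (i + (l - 1)) mod l"
    have l3: "l \<ge> 3" using len by (simp add: l_def)
    have lt: "s < l" "p < l" using i by (simp_all add: s_def p_def)
    have sp: "s = (if Suc i = l then 0 else Suc i)" using i by (simp add: s_def)
    have pp: "p = (if i = 0 then l - 1 else i - 1)"
    proof (cases "i = 0")
      case False
      then have "i + (l - 1) = (i - 1) + l" using l3 by linarith
      then have "p = (i - 1) mod l" unfolding p_def by (simp only: mod_add_self2)
      then show ?thesis using i False by simp
    qed (use l3 in \<open>simp add: p_def\<close>)
    have "Suc p mod l = i" using i l3 by (auto simp: pp)
    then have "{vs ! i, vs ! p} \<in> ?T" using edge[of p] lt by (simp add: l_def insert_commute)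
    moreover have "{vs ! i, vs ! s} \<in> ?T" using edge[of i] i by (simp add: l_def s_def)
    ultimately have "vs ! p = par (vs ! i)" "vs ! s = par (vs ! i)"
      using max lt by (auto intro!: parent)
    then have "vs ! p = vs ! s" by simp
    then have "p = s" using dist lt by (simp add: nth_eq_iff_index_eq l_def)
    then show False using sp pp l3 i by (auto split: if_splits)
  qed
  ultimately show ?thesis by (auto simp: is_tree_def)
qed

lemma tree_no_triangle:
  assumes "is_tree V T" "x \<noteq> y" "y \<noteq> z" "x \<noteq> z" "{x, y} \<in> T" "{y, z} \<in> T" "{x, z} \<in> T"
  shows False
proof -
  have "is_cycle T [x, y, z]"
    using assms(2-) by (auto simp: is_cycle_def less_Suc_eq insert_commute[of z x])
  then show False using assms(1) by (auto simp: is_tree_def)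
qed

definition block_parent :: "nat \<Rightarrow> nat \<Rightarrow> (nat \<times> nat \<Rightarrow> nat) \<Rightarrow> (nat \<Rightarrow> nat) \<Rightarrow> nat \<Rightarrow> nat" where
  "block_parent r k q c v =
     (if v \<in> q ` positions k then
        case inv_into (positions k) q v of (i, j) \<Rightarrow>
          if j = 0 \<and> c i = 1 then q (i, 1) else if j = 1 \<and> c i = 0 then q (i, 0) else r
      else r)"

definition block_tree :: "nat \<Rightarrow> nat \<Rightarrow> (nat \<times> nat \<Rightarrow> nat) \<Rightarrow> (nat \<Rightarrow> nat) \<Rightarrow> nat set set" where
  "block_tree n k q c = (\<lambda>v. {v, block_parent n k q c v}) ` ({1..n} - {n})"

lemma placement_mem:
  assumes "q \<in> placements k V" "i < k" "j < 3"
  shows "q (i, j) \<in> V"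
proof -
  have "q \<in> positions k \<rightarrow>\<^sub>E V" using assms(1) by (simp add: placements_def)
  from PiE_mem[OF this, of "(i, j)"] show ?thesis using assms(2,3) by simp
qed

lemma placement_eq_iff:
  assumes "q \<in> placements k V" "i < k" "j < 3" "i' < k" "j' < 3"
  shows "q (i, j) = q (i', j') \<longleftrightarrow> i = i' \<and> j = j'"
proof -
  have "inj_on q (positions k)" using assms(1) by (simp add: placements_def)
  from inj_on_eq_iff[OF this, of "(i, j)" "(i', j')"] show ?thesis using assms by simp
qed

lemma block_parent_position:
  assumes "q \<in> placements k V" "i < k" "j < 3"
  shows "block_parent r k q c (q (i, j)) =
    (if j = 0 \<and> c i = 1 then q (i, 1) else if j = 1 \<and> c i = 0 then q (i, 0) else r)"
proof -
  have "inj_on q (positions k)" using assms(1) by (simp add: placements_def)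
  then have "inv_into (positions k) q (q (i, j)) = (i, j)"
    using assms by (intro inv_into_f_f) simp_all
  moreover have "q (i, j) \<in> q ` positions k" using assms by (intro imageI) simp
  ultimately show ?thesis by (simp add: block_parent_def)
qed

lemma block_tree_edges:
  assumes q: "q \<in> placements k {1..<n}" and i: "i < k"
  shows "{n, q (i, 2)} \<in> block_tree n k q c"
    and "c i \<noteq> 1 \<Longrightarrow> {n, q (i, 0)} \<in> block_tree n k q c"
    and "c i \<noteq> 0 \<Longrightarrow> {n, q (i, 1)} \<in> block_tree n k q c"
    and "c i = 0 \<or> c i = 1 \<Longrightarrow> {q (i, 0), q (i, 1)} \<in> block_tree n k q c"
proof -
  have edge: "{block_parent n k q c (q (i, j)), q (i, j)} \<in> block_tree n k q c" if "j < 3" for j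
  proof -
    have "q (i, j) \<in> {1..n} - {n}" using placement_mem[OF q i that] by simp
    then have "{q (i, j), block_parent n k q c (q (i, j))} \<in> block_tree n k q c"
      unfolding block_tree_def by (rule imageI)
    then show ?thesis by (simp only: insert_commute)
  qed
  note parent = block_parent_position[OF q i]
  show "{n, q (i, 2)} \<in> block_tree n k q c" using edge[of 2] by (simp add: parent)
  show "{n, q (i, 0)} \<in> block_tree n k q c" if "c i \<noteq> 1" using edge[of 0] that by (simp add: parent)
  show "{n, q (i, 1)} \<in> block_tree n k q c" if "c i \<noteq> 0" using edge[of 1] that by (simp add: parent)
  show "{q (i, 0), q (i, 1)} \<in> block_tree n k q c" if "c i = 0 \<or> c i = 1"
    using that
  proof
    assume "c i = 0"
    then show ?thesis using edge[of 1] by (simp add: parent)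
  next
    assume "c i = 1"
    then show ?thesis using edge[of 0] by (simp add: parent insert_commute)
  qed
qed

lemma block_tree_spanning:
  assumes q: "q \<in> placements k {1..<n}" and n: "n \<ge> 1"
  shows "block_tree n k q c \<in> spanning_trees n"
proof -
  define par where "par = block_parent n k q c"
  define rank where "rank v = (if v = n then 0 else if par v = n then 1 else 2 :: nat)" for v
  have desc: "par v \<in> {1..n} \<and> rank (par v) < rank v" if v: "v \<noteq> n" for v
  proof (cases "par v = n")
    case True
    then show ?thesis using n v by (simp add: rank_def)
  next
    case False
    then have "v \<in> q ` positions k" by (auto simp: par_def block_parent_def split: if_splits)
    then obtain i j where ij: "v = q (i, j)" "i < k" "j < 3" by auto
    note parent = block_parent_position[OF q ij(2)]
    have "(j = 0 \<and> c i = 1) \<or> (j = 1 \<and> c i = 0)"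
      using False parent[OF ij(3), of n c] by (simp add: par_def ij(1) split: if_splits)
    then obtain j' where j': "j' < 3" "par v = q (i, j')" "par (par v) = n"
    proof
      assume "j = 0 \<and> c i = 1"
      then show thesis using that[of 1] parent[of 0 n c] parent[of 1 n c] by (simp add: par_def ij(1))
    next
      assume "j = 1 \<and> c i = 0"
      then show thesis using that[of 0] parent[of 0 n c] parent[of 1 n c] by (simp add: par_def ij(1))
    qed
    moreover have "q (i, j') \<in> {1..<n}" using placement_mem[OF q ij(2) j'(1)] .
    ultimately show ?thesis using False v by (simp add: rank_def)
  qed
  have tree: "is_tree {1..n} (block_tree n k q c)"
    unfolding block_tree_def par_def[symmetric]
    by (rule is_tree_parent[where rank = rank]) (use n desc in simp_all)
  have par: "par v \<in> {1..n} \<and> par v \<noteq> v" if "v \<noteq> n" for v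
    using desc[OF that] by (metis less_irrefl)
  have "{v, par v} \<in> complete_edges n" if "v \<in> {1..n} - {n}" for v
    using that par[of v] by (auto simp: complete_edges_def card_insert_if)
  then have "block_tree n k q c \<subseteq> complete_edges n"
    unfolding block_tree_def par_def[symmetric] by (rule image_subsetI)
  with tree show ?thesis by (simp add: spanning_trees_def)
qed

section \<open>Balanced factorizations in monotone circuits\<close>

definition nonneg_poly :: "'v mpoly \<Rightarrow> bool" where
  "nonneg_poly p \<longleftrightarrow> (\<forall>a. 0 \<le> Poly_Mapping.lookup p a)"

lemma keys_add_nonneg:
  assumes "nonneg_poly p" "nonneg_poly q"
  shows "nonneg_poly (p + q)" "Poly_Mapping.keys (p + q) = Poly_Mapping.keys p \<union> Poly_Mapping.keys q"
proof -
  have "Poly_Mapping.lookup (p + q) a = 0 \<longleftrightarrow> Poly_Mapping.lookup p a = 0 \<and> Poly_Mapping.lookup q a = 0" for a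
    using assms by (simp add: nonneg_poly_def lookup_add add_nonneg_eq_0_iff)
  then show "Poly_Mapping.keys (p + q) = Poly_Mapping.keys p \<union> Poly_Mapping.keys q"
    unfolding in_keys_iff set_eq_iff Un_iff by blast
qed (use assms in \<open>simp add: nonneg_poly_def lookup_add\<close>)

lemma keys_sum_nonneg:
  assumes "finite I" "\<And>i. i \<in> I \<Longrightarrow> nonneg_poly (f i)"
  shows "nonneg_poly (sum f I) \<and> Poly_Mapping.keys (sum f I) = (\<Union>i\<in>I. Poly_Mapping.keys (f i))"
  using assms
proof (induction I rule: finite_induct)
  case (insert i I)
  then show ?case by (auto simp: keys_add_nonneg)
qed (simp add: nonneg_poly_def)

lemma poly_eq_sum_single:
  fixes p :: "'a \<Rightarrow>\<^sub>0 'b::comm_monoid_add"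
  shows "p = (\<Sum>a\<in>Poly_Mapping.keys p. Poly_Mapping.single a (Poly_Mapping.lookup p a))"
  by (rule poly_mapping_eqI)
    (simp add: lookup_sum lookup_single when_def sum.delta not_in_keys_iff_lookup_eq_zero)

lemma keys_mult_nonneg:
  fixes p q :: "'v mpoly"
  assumes p: "nonneg_poly p" and q: "nonneg_poly q"
  shows "nonneg_poly (p * q)"
    and "Poly_Mapping.keys (p * q) = {a + b | a b. a \<in> Poly_Mapping.keys p \<and> b \<in> Poly_Mapping.keys q}"
proof -
  define t where "t a b = Poly_Mapping.single (a + b) (Poly_Mapping.lookup p a * Poly_Mapping.lookup q b)" for a b
  have "p * q = (\<Sum>a\<in>Poly_Mapping.keys p. Poly_Mapping.single a (Poly_Mapping.lookup p a)) *
      (\<Sum>b\<in>Poly_Mapping.keys q. Poly_Mapping.single b (Poly_Mapping.lookup q b))"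
    by (intro arg_cong2[where f = times] poly_eq_sum_single)
  also have "\<dots> = (\<Sum>a\<in>Poly_Mapping.keys p. \<Sum>b\<in>Poly_Mapping.keys q. t a b)"
    by (simp add: sum_product mult_single t_def)
  finally have pq: "p * q = (\<Sum>a\<in>Poly_Mapping.keys p. \<Sum>b\<in>Poly_Mapping.keys q. t a b)" .
  have t: "nonneg_poly (t a b)" for a b
    using p q by (simp add: nonneg_poly_def t_def lookup_single when_def)
  have inner: "nonneg_poly (\<Sum>b\<in>Poly_Mapping.keys q. t a b) \<and>
      Poly_Mapping.keys (\<Sum>b\<in>Poly_Mapping.keys q. t a b) = (\<Union>b\<in>Poly_Mapping.keys q. Poly_Mapping.keys (t a b))" for a
    by (intro keys_sum_nonneg t) simp
  have "nonneg_poly (p * q) \<and>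
    Poly_Mapping.keys (p * q) = (\<Union>a\<in>Poly_Mapping.keys p. \<Union>b\<in>Poly_Mapping.keys q. Poly_Mapping.keys (t a b))"
    unfolding pq using keys_sum_nonneg[OF finite_keys, of p "\<lambda>a. \<Sum>b\<in>Poly_Mapping.keys q. t a b"] inner
    by simp
  moreover have "Poly_Mapping.keys (t a b) = {a + b}"
    if "a \<in> Poly_Mapping.keys p" "b \<in> Poly_Mapping.keys q" for a b
    using that by (auto simp: t_def)
  ultimately show "nonneg_poly (p * q)"
    "Poly_Mapping.keys (p * q) = {a + b | a b. a \<in> Poly_Mapping.keys p \<and> b \<in> Poly_Mapping.keys q}"
    by auto
qed

lemma gate_poly_nonneg:
  assumes "gate_poly C g p" "monotone_circuit X C" "g \<in> gates C"
  shows "nonneg_poly p"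
  using assms
proof (induction rule: gate_poly.induct)
  case (1 g x)
  then show ?case by (simp add: nonneg_poly_def pvar_def lookup_single when_def)
next
  case (2 g c)
  then have "label_ok X (Const c :: 'a gate_label)" unfolding monotone_circuit_def by metis
  then show ?case by (simp add: nonneg_poly_def pconst_def lookup_single when_def)
next
  case (3 g h k p q)
  then have "inputs (Plus h k :: 'a gate_label) \<subseteq> gates C" unfolding monotone_circuit_def by metis
  then show ?case using 3 by (simp add: keys_add_nonneg)
next
  case (4 g h k p q)
  then have "inputs (Times h k :: 'a gate_label) \<subseteq> gates C" unfolding monotone_circuit_def by metis
  then show ?case using 4 by (simp add: keys_mult_nonneg)
qed

definition cofactors :: "'v mpoly \<Rightarrow> 'v mpoly \<Rightarrow> ('v \<Rightarrow>\<^sub>0 nat) set" where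
  "cofactors f p = {b. \<forall>a\<in>Poly_Mapping.keys p. a + b \<in> Poly_Mapping.keys f}"

definition weight :: "'v set \<Rightarrow> ('v \<Rightarrow>\<^sub>0 nat) \<Rightarrow> nat" where
  "weight D a = card (D \<inter> Poly_Mapping.keys a)"

lemma weight_add: "finite D \<Longrightarrow> weight D (a + b) \<le> weight D a + weight D b"
proof -
  assume "finite D"
  then have "card (D \<inter> Poly_Mapping.keys (a + b)) \<le>
      card (D \<inter> Poly_Mapping.keys a \<union> D \<inter> Poly_Mapping.keys b)"
    using keys_add[of a b] by (intro card_mono) auto
  also have "\<dots> \<le> weight D a + weight D b" unfolding weight_def by (rule card_Un_le)
  finally show ?thesis by (simp add: weight_def)
qed

lemma heavy_gate_not_input:
  assumes "gate_poly C g p" "a \<in> Poly_Mapping.keys p" "1 < weight D a"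
  shows "inputs (label C g) \<noteq> {}"
  using assms(1)
proof cases
  case (1 x)
  then have "weight D a \<le> card {x}" using assms(2) unfolding weight_def
    by (intro card_mono) (auto simp: pvar_def)
  then show ?thesis using assms(3) by simp
next
  case (2 c)
  then show ?thesis using assms(2,3) by (auto simp: pconst_def weight_def split: if_splits)
qed auto

text \<open>From a gate contributing a heavy factor of a monomial, descend to the heavier input. The weight
  at most halves at a product gate, so the first weight that is at most \<open>2m\<close> still exceeds \<open>m\<close>.\<close>

lemma balanced_factor:
  assumes "gate_poly C g p" "monotone_circuit X C" "g \<in> gates C"
    and "finite D" "m \<ge> 1"
    and "a \<in> Poly_Mapping.keys p" "b \<in> cofactors f p" "2 * m < weight D a"
  shows "\<exists>h\<in>gates C. inputs (label C h) \<noteq> {} \<and> (\<exists>p' a' b'. gate_poly C h p' \<and>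
    a' \<in> Poly_Mapping.keys p' \<and> b' \<in> cofactors f p' \<and> a' + b' = a + b \<and>
    m < weight D a' \<and> weight D a' \<le> 2 * m)" (is "?P (a + b)")
  using assms
proof (induction arbitrary: a b rule: gate_poly.induct)
  case (1 g x)
  then have "inputs (label C g) \<noteq> {}"
    by (intro heavy_gate_not_input[of C g "pvar x" a D] gate_poly.intros) auto
  then show ?case using 1(1) by simp
next
  case (2 g c)
  then have "inputs (label C g) \<noteq> {}"
    by (intro heavy_gate_not_input[of C g "pconst c" a D] gate_poly.intros) auto
  then show ?case using 2(1) by simp
next
  case (3 g h k p q)
  from 3 have "inputs (Plus h k :: 'a gate_label) \<subseteq> gates C" unfolding monotone_circuit_def by metis
  then have hk: "h \<in> gates C" "k \<in> gates C" by auto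
  note keys = keys_add_nonneg[OF gate_poly_nonneg[OF 3(2) 3(6) hk(1)] gate_poly_nonneg[OF 3(3) 3(6) hk(2)]]
  have "b \<in> cofactors f p" "b \<in> cofactors f q"
    using 3 by (auto simp: cofactors_def keys)
  then show ?case using 3 hk keys by blast
next
  case (4 g h k p q)
  from 4 have "inputs (Times h k :: 'a gate_label) \<subseteq> gates C" unfolding monotone_circuit_def by metis
  then have hk: "h \<in> gates C" "k \<in> gates C" by auto
  note keys = keys_mult_nonneg[OF gate_poly_nonneg[OF 4(2) 4(6) hk(1)] gate_poly_nonneg[OF 4(3) 4(6) hk(2)]]
  obtain a1 a2 where a: "a = a1 + a2" "a1 \<in> Poly_Mapping.keys p" "a2 \<in> Poly_Mapping.keys q"
    using 4 keys by auto
  have cof: "a2 + b \<in> cofactors f p" "a1 + b \<in> cofactors f q"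
  proof -
    have "a' + (a2 + b) \<in> Poly_Mapping.keys f" if "a' \<in> Poly_Mapping.keys p" for a'
    proof -
      have "a' + a2 \<in> Poly_Mapping.keys (p * q)" using that a keys by auto
      then show ?thesis using 4 by (auto simp: cofactors_def add.assoc)
    qed
    moreover have "a' + (a1 + b) \<in> Poly_Mapping.keys f" if "a' \<in> Poly_Mapping.keys q" for a'
    proof -
      have "a1 + a' \<in> Poly_Mapping.keys (p * q)" using that a keys by auto
      then have "(a1 + a') + b \<in> Poly_Mapping.keys f" using 4 by (auto simp: cofactors_def)
      then show ?thesis by (simp add: add.left_commute add.assoc)
    qed
    ultimately show "a2 + b \<in> cofactors f p" "a1 + b \<in> cofactors f q" by (auto simp: cofactors_def)
  qed
  have eq: "a1 + (a2 + b) = a + b" "a2 + (a1 + b) = a + b" by (simp_all add: a ac_simps)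
  have heavy: "m < weight D a1 \<or> m < weight D a2"
    using weight_add[OF 4(8), of a1 a2] 4(12) unfolding a(1) by linarith
  show ?case
  proof (cases "2 * m < weight D a1 \<or> 2 * m < weight D a2")
    case True
    then show ?thesis
    proof
      assume "2 * m < weight D a1"
      from 4(4)[OF 4(6) hk(1) 4(8,9) a(2) cof(1) this] show ?thesis by (simp only: eq)
    next
      assume "2 * m < weight D a2"
      from 4(5)[OF 4(6) hk(2) 4(8,9) a(3) cof(2) this] show ?thesis by (simp only: eq)
    qed
  next
    case False
    from heavy show ?thesis
    proof
      assume "m < weight D a1"
      moreover from this have "1 < weight D a1" using 4(9) by linarith
      ultimately show ?thesis
        using heavy_gate_not_input[OF 4(2) a(2)] hk(1) 4(2) a(2) cof(1) eq(1) False by (metis not_le)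
    next
      assume "m < weight D a2"
      moreover from this have "1 < weight D a2" using 4(9) by linarith
      ultimately show ?thesis
        using heavy_gate_not_input[OF 4(3) a(3)] hk(2) 4(3) a(3) cof(2) eq(2) False by (metis not_le)
    qed
  qed
qed

section \<open>Straight-line circuits\<close>

definition wf_labels :: "'v set \<Rightarrow> nat \<Rightarrow> (nat \<Rightarrow> 'v gate_label) \<Rightarrow> bool" where
  "wf_labels X N l \<longleftrightarrow> (\<forall>g<N. label_ok X (l g) \<and> inputs (l g) \<subseteq> {..<g})"

definition line_circuit :: "(nat \<Rightarrow> 'v gate_label) \<Rightarrow> nat \<Rightarrow> nat \<Rightarrow> 'v circuit" where
  "line_circuit l N g = \<lparr>gates = {..<N}, label = l, out = g\<rparr>"

text \<open>Quantifying over an arbitrary initial segment \<open>l\<close> lets circuits be composed without renumbering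
  gates.\<close>

definition line_computable :: "'v set \<Rightarrow> 'v mpoly \<Rightarrow> bool" where
  "line_computable X f \<longleftrightarrow> (\<forall>N l. wf_labels X N l \<longrightarrow>
     (\<exists>N' l' g. N \<le> N' \<and> wf_labels X N' l' \<and> (\<forall>i<N. l' i = l i) \<and> g < N' \<and>
        gate_poly (line_circuit l' N' g) g f))"

lemma monotone_line_circuit:
  assumes "wf_labels X N l" "g < N"
  shows "monotone_circuit X (line_circuit l N g)"
proof -
  have "wires (line_circuit l N g) \<subseteq> {(a, b). a < b}"
    using assms by (auto simp: wires_def line_circuit_def wf_labels_def)
  then have "acyclic (wires (line_circuit l N g))"
    by (meson acyclic_subset wf_acyclic wf_less)
  moreover have "inputs (l h) \<subseteq> {..<N}" if "h < N" for h
    using assms that by (fastforce simp: wf_labels_def)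
  ultimately show ?thesis
    using assms by (auto simp: monotone_circuit_def line_circuit_def wf_labels_def)
qed

lemma gate_poly_extend:
  assumes "gate_poly C g p" "label C = l" "g < N" "wf_labels X N l" "\<forall>i<N. label C' i = l i"
  shows "gate_poly C' g p"
  using assms
proof (induction rule: gate_poly.induct)
  case (3 g h k p q)
  then have "h < N" "k < N" by (fastforce simp: wf_labels_def)+
  then show ?case using 3 by (auto intro: gate_poly.intros)
next
  case (4 g h k p q)
  then have "h < N" "k < N" by (fastforce simp: wf_labels_def)+
  then show ?case using 4 by (auto intro: gate_poly.intros)
qed (auto intro: gate_poly.intros)

lemma line_computable_input:
  assumes "label_ok X L" "inputs L = {}" "\<And>C g. label C g = L \<Longrightarrow> gate_poly C g f"
  shows "line_computable X f"
  unfolding line_computable_def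
proof (intro allI impI)
  fix N l assume "wf_labels X N l"
  then have "N \<le> Suc N \<and> wf_labels X (Suc N) (l(N := L)) \<and> (\<forall>i<N. (l(N := L)) i = l i) \<and> N < Suc N \<and>
    gate_poly (line_circuit (l(N := L)) (Suc N) N) N f"
    using assms by (auto simp: wf_labels_def line_circuit_def less_Suc_eq)
  then show "\<exists>N' l' g. N \<le> N' \<and> wf_labels X N' l' \<and> (\<forall>i<N. l' i = l i) \<and> g < N' \<and>
    gate_poly (line_circuit l' N' g) g f" by blast
qed

lemma line_computable_gate:
  assumes f: "line_computable X p" "line_computable X q"
    and L: "\<And>h k. label_ok X (L h k)" "\<And>h k. inputs (L h k) = {h, k}"
    and gate: "\<And>C g h k. label C g = L h k \<Longrightarrow> gate_poly C h p \<Longrightarrow> gate_poly C k q \<Longrightarrow> gate_poly C g f"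
  shows "line_computable X f"
  unfolding line_computable_def
proof (intro allI impI)
  fix N l assume "wf_labels X N l"
  then obtain N1 l1 h where 1: "N \<le> N1" "wf_labels X N1 l1" "\<forall>i<N. l1 i = l i" "h < N1"
    "gate_poly (line_circuit l1 N1 h) h p"
    using f(1) unfolding line_computable_def by blast
  then obtain N2 l2 k where 2: "N1 \<le> N2" "wf_labels X N2 l2" "\<forall>i<N1. l2 i = l1 i" "k < N2"
    "gate_poly (line_circuit l2 N2 k) k q"
    using f(2) unfolding line_computable_def by blast
  define l3 where "l3 = l2(N2 := L h k)"
  let ?C = "line_circuit l3 (Suc N2) N2"
  have "gate_poly ?C h p"
    by (rule gate_poly_extend[OF 1(5) _ 1(4,2)]) (use 2 in \<open>auto simp: line_circuit_def l3_def\<close>)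
  moreover have "gate_poly ?C k q"
    by (rule gate_poly_extend[OF 2(5) _ 2(4,2)]) (auto simp: line_circuit_def l3_def)
  ultimately have "gate_poly ?C N2 f"
    by (intro gate) (auto simp: line_circuit_def l3_def)
  moreover have "wf_labels X (Suc N2) l3"
    using 1 2 L by (auto simp: wf_labels_def l3_def less_Suc_eq)
  moreover have "\<forall>i<N. l3 i = l i" using 1 2 by (auto simp: l3_def)
  ultimately show "\<exists>N' l' g. N \<le> N' \<and> wf_labels X N' l' \<and> (\<forall>i<N. l' i = l i) \<and> g < N' \<and>
    gate_poly (line_circuit l' N' g) g f"
    using 1 2 by (intro exI[of _ "Suc N2"] exI[of _ l3] exI[of _ N2]) auto
qed

lemma line_computable_const: "c \<ge> 0 \<Longrightarrow> line_computable X (pconst c)"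
  by (rule line_computable_input[of _ "Const c"]) (auto intro: gate_poly.intros)

lemma line_computable_var: "x \<in> X \<Longrightarrow> line_computable X (pvar x)"
  by (rule line_computable_input[of _ "Var x"]) (auto intro: gate_poly.intros)

lemma line_computable_add:
  assumes "line_computable X p" "line_computable X q"
  shows "line_computable X (p + q)"
  by (rule line_computable_gate[OF assms, where L = Plus]) (simp_all add: gate_poly.intros(3))

lemma line_computable_mult:
  assumes "line_computable X p" "line_computable X q"
  shows "line_computable X (p * q)"
  by (rule line_computable_gate[OF assms, where L = Times]) (simp_all add: gate_poly.intros(4))

lemma line_computable_sum:
  assumes "finite I" "\<And>i. i \<in> I \<Longrightarrow> line_computable X (f i)"
  shows "line_computable X (sum f I)"
  using assms
proof (induction I rule: finite_induct)
  case empty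
  then show ?case using line_computable_const[of 0 X] by (simp add: pconst_def)
next
  case (insert i I)
  then show ?case
    by (simp add: line_computable_add)
qed

lemma line_computable_prod:
  assumes "finite I" "\<And>i. i \<in> I \<Longrightarrow> line_computable X (f i)"
  shows "line_computable X (prod f I)"
  using assms
proof (induction I rule: finite_induct)
  case empty
  then show ?case using line_computable_const[of 1 X] by (simp add: pconst_def)
next
  case (insert i I)
  then show ?case
    by (simp add: line_computable_mult)
qed

lemma monotone_complexity_attained:
  assumes "line_computable X f"
  obtains C where "monotone_circuit X C" "computes C f" "circuit_size C = monotone_complexity X f"
proof -
  have "wf_labels X 0 (\<lambda>_. Const 0)" by (simp add: wf_labels_def)
  then obtain N l g where "wf_labels X N l" "g < N" "gate_poly (line_circuit l N g) g f"
    using assms unfolding line_computable_def by blast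
  then have "monotone_circuit X (line_circuit l N g)" "computes (line_circuit l N g) f"
    by (simp_all add: monotone_line_circuit computes_def) (simp add: line_circuit_def)
  then have "{circuit_size C | C. monotone_circuit X C \<and> computes C f} \<noteq> {}" by blast
  from Inf_nat_def1[OF this] show thesis
    using that unfolding monotone_complexity_def by auto
qed

section \<open>Rectangles of spanning trees\<close>

definition edge_monomial :: "'e set \<Rightarrow> 'e \<Rightarrow>\<^sub>0 nat" where
  "edge_monomial T = (\<Sum>e\<in>T. Poly_Mapping.single e 1)"

lemma lookup_edge_monomial:
  assumes "finite T"
  shows "Poly_Mapping.lookup (edge_monomial T) e = (if e \<in> T then 1 else 0)"
  using assms by (simp add: edge_monomial_def lookup_sum lookup_single when_def sum.delta)

lemma keys_edge_monomial:
  assumes "finite T"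
  shows "Poly_Mapping.keys (edge_monomial T) = T"
  using lookup_edge_monomial[OF assms] by (auto simp: set_eq_iff in_keys_iff split: if_splits)

lemma prod_pvar: "finite T \<Longrightarrow> (\<Prod>e\<in>T. pvar e) = Poly_Mapping.single (edge_monomial T) 1"
proof (induction T rule: finite_induct)
  case (insert e T)
  then show ?case by (simp add: edge_monomial_def pvar_def mult_single)
qed (simp add: edge_monomial_def)

lemma finite_complete_edges: "finite (complete_edges n)"
  by (rule finite_subset[of _ "Pow {1..n}"]) (auto simp: complete_edges_def)

lemma finite_spanning_tree: "T \<in> spanning_trees n \<Longrightarrow> finite T"
  using finite_subset[OF _ finite_complete_edges] by (auto simp: spanning_trees_def)

lemma finite_spanning_trees: "finite (spanning_trees n)"
  by (rule finite_subset[of _ "Pow (complete_edges n)"])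
    (auto simp: spanning_trees_def finite_complete_edges)

lemma keys_spanning_tree_poly:
  "Poly_Mapping.keys (spanning_tree_poly n) = edge_monomial ` spanning_trees n"
proof -
  have eq: "spanning_tree_poly n = (\<Sum>T\<in>spanning_trees n. Poly_Mapping.single (edge_monomial T) 1)"
    unfolding spanning_tree_poly_def by (intro sum.cong refl prod_pvar finite_spanning_tree)
  have "Poly_Mapping.keys (spanning_tree_poly n) =
      (\<Union>T\<in>spanning_trees n. Poly_Mapping.keys (Poly_Mapping.single (edge_monomial T) (1::real)))"
    unfolding eq
    by (intro conjunct2[OF keys_sum_nonneg] finite_spanning_trees)
      (simp add: nonneg_poly_def lookup_single when_def)
  then show ?thesis by auto
qed

lemma spanning_tree_poly_line_computable: "line_computable (complete_edges n) (spanning_tree_poly n)"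
  unfolding spanning_tree_poly_def
proof (intro line_computable_sum line_computable_prod line_computable_var)
  show "e \<in> complete_edges n" if "T \<in> spanning_trees n" "e \<in> T" for T e
    using that by (auto simp: spanning_trees_def)
qed (simp_all add: finite_spanning_trees finite_spanning_tree)

definition factor_edges :: "'e mpoly \<Rightarrow> 'e set" where
  "factor_edges p = \<Union> (Poly_Mapping.keys ` Poly_Mapping.keys p)"

definition cofactor_edges :: "'e mpoly \<Rightarrow> 'e mpoly \<Rightarrow> 'e set" where
  "cofactor_edges f p = \<Union> (Poly_Mapping.keys ` cofactors f p)"

lemma factor_cofactor:
  assumes "a \<in> Poly_Mapping.keys p" "b \<in> cofactors (spanning_tree_poly n) p"
  obtains T where "T \<in> spanning_trees n" "a + b = edge_monomial T"
    "Poly_Mapping.keys a \<inter> Poly_Mapping.keys b = {}" "Poly_Mapping.keys a \<union> Poly_Mapping.keys b = T"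
proof -
  obtain T where T: "T \<in> spanning_trees n" "a + b = edge_monomial T"
    using assms by (auto simp: cofactors_def keys_spanning_tree_poly)
  have look: "Poly_Mapping.lookup a e + Poly_Mapping.lookup b e = (if e \<in> T then 1 else 0)" for e
    using lookup_edge_monomial[OF finite_spanning_tree[OF T(1)], of e] T(2) by (metis lookup_add)
  have "\<not> (e \<in> Poly_Mapping.keys a \<and> e \<in> Poly_Mapping.keys b)"
    and "e \<in> Poly_Mapping.keys a \<or> e \<in> Poly_Mapping.keys b \<longleftrightarrow> e \<in> T" for e
    using look[of e] unfolding in_keys_iff by (simp_all split: if_splits) linarith+
  then show thesis by (intro that[OF T]) blast+
qed

lemma factor_cofactor_edges_disjoint:
  "factor_edges p \<inter> cofactor_edges (spanning_tree_poly n) p = {}"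
proof -
  have "Poly_Mapping.keys a \<inter> Poly_Mapping.keys b = {}"
    if "a \<in> Poly_Mapping.keys p" "b \<in> cofactors (spanning_tree_poly n) p" for a b
    using factor_cofactor[OF that] by blast
  then show ?thesis unfolding factor_edges_def cofactor_edges_def by blast
qed

text \<open>If two edges of a triangle lie in the factor \<open>a\<close> and the third in some cofactor \<open>b'\<close>, then
  the tree of the monomial \<open>a + b'\<close> contains the triangle.\<close>

lemma cherry_ok_tree:
  assumes a: "a \<in> Poly_Mapping.keys p" and b: "b \<in> cofactors (spanning_tree_poly n) p"
    and e: "{x, y} \<in> Poly_Mapping.keys a \<union> Poly_Mapping.keys b"
    and f: "{y, z} \<in> Poly_Mapping.keys a \<union> Poly_Mapping.keys b"
    and dist: "x \<noteq> y" "y \<noteq> z" "x \<noteq> z"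
  shows "cherry_ok (factor_edges p) (cofactor_edges (spanning_tree_poly n) p) {x, y} {y, z} {x, z}"
proof -
  let ?R = "factor_edges p" and ?B = "cofactor_edges (spanning_tree_poly n) p"
  have sub: "Poly_Mapping.keys a \<subseteq> ?R" "Poly_Mapping.keys b \<subseteq> ?B"
    using a b unfolding factor_edges_def cofactor_edges_def by blast+
  note disj = factor_cofactor_edges_disjoint[of p n]
  have no_triangle: False
    if ab: "a' \<in> Poly_Mapping.keys p" "b' \<in> cofactors (spanning_tree_poly n) p"
      "{{x, y}, {y, z}, {x, z}} \<subseteq> Poly_Mapping.keys a' \<union> Poly_Mapping.keys b'" for a' b'
  proof -
    obtain T where "T \<in> spanning_trees n" "{{x, y}, {y, z}, {x, z}} \<subseteq> T"
      using factor_cofactor[OF ab(1,2)] ab(3) by metis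
    then show False
      using tree_no_triangle[of "{1..n}" T x y z] dist by (simp add: spanning_trees_def)
  qed
  have "\<not> ({x, y} \<in> ?R \<and> {y, z} \<in> ?R \<and> {x, z} \<in> ?B)"
  proof
    assume *: "{x, y} \<in> ?R \<and> {y, z} \<in> ?R \<and> {x, z} \<in> ?B"
    then obtain b' where "b' \<in> cofactors (spanning_tree_poly n) p" "{x, z} \<in> Poly_Mapping.keys b'"
      unfolding cofactor_edges_def by blast
    moreover have "{x, y} \<in> Poly_Mapping.keys a" "{y, z} \<in> Poly_Mapping.keys a"
      using * e f sub disj by blast+
    ultimately show False using no_triangle[OF a] by blast
  qed
  moreover have "\<not> ({x, y} \<in> ?B \<and> {y, z} \<in> ?B \<and> {x, z} \<in> ?R)"
  proof
    assume *: "{x, y} \<in> ?B \<and> {y, z} \<in> ?B \<and> {x, z} \<in> ?R"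
    then obtain a' where "a' \<in> Poly_Mapping.keys p" "{x, z} \<in> Poly_Mapping.keys a'"
      unfolding factor_edges_def by blast
    moreover have "{x, y} \<in> Poly_Mapping.keys b" "{y, z} \<in> Poly_Mapping.keys b"
      using * e f sub disj by blast+
    ultimately show False using no_triangle[OF _ b] by blast
  qed
  ultimately show ?thesis using e f sub unfolding cherry_ok_def by blast
qed

lemma block_tree_all_ok:
  assumes q: "q \<in> placements k {1..<n}"
    and a: "a \<in> Poly_Mapping.keys p" and b: "b \<in> cofactors (spanning_tree_poly n) p"
    and T: "Poly_Mapping.keys a \<union> Poly_Mapping.keys b = block_tree n k q c"
  shows "all_ok (factor_edges p) (cofactor_edges (spanning_tree_poly n) p) n k q c"
  unfolding all_ok_def
proof (intro allI impI conjI)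
  fix i assume i: "i < k"
  note edges = block_tree_edges[OF q i, of c, folded T]
  note cherry = cherry_ok_tree[OF a b]
  have dist: "q (i, 0) \<noteq> q (i, 1)" "n \<noteq> q (i, 0)" "n \<noteq> q (i, 1)"
    using placement_eq_iff[OF q i _ i, of 0 1] placement_mem[OF q i, of 0] placement_mem[OF q i, of 1]
    by auto
  consider "c i = 0" | "c i = 1" | "c i \<noteq> 0" "c i \<noteq> 1" by blast
  then show "pair_ok (factor_edges p) (cofactor_edges (spanning_tree_poly n) p) n (q (i, 0)) (q (i, 1)) (c i)"
  proof cases
    case 1
    then show ?thesis
      using cherry[of n "q (i, 0)" "q (i, 1)"] edges dist by (simp add: pair_ok_def)
  next
    case 2
    then show ?thesis
      using cherry[of n "q (i, 1)" "q (i, 0)"] edges dist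
      by (simp add: pair_ok_def insert_commute[of "q (i, Suc 0)" "q (i, 0)" "{}"])
  next
    case 3
    then show ?thesis
      using cherry[of "q (i, 0)" n "q (i, 1)"] edges dist
      by (simp add: pair_ok_def insert_commute[of "q (i, 0)" n "{}"])
  qed
  show "{n, q (i, 2)} \<in> factor_edges p \<union> cofactor_edges (spanning_tree_poly n) p"
    using edges(1) a b unfolding factor_edges_def cofactor_edges_def by blast
qed

lemma placement_factorization:
  assumes C: "monotone_circuit X C" "computes C (spanning_tree_poly n)"
    and m: "m \<ge> 1" and n: "n \<ge> 1" and q: "q \<in> placements (3 * m) {1..<n}"
  obtains h p where "h \<in> gates C" "inputs (label C h) \<noteq> {}" "gate_poly C h p"
    "all_ok (factor_edges p) (cofactor_edges (spanning_tree_poly n) p) n (3 * m) q c"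
    "balanced (factor_edges p) (cofactor_edges (spanning_tree_poly n) p) n (3 * m) m q"
proof -
  let ?k = "3 * m" and ?f = "spanning_tree_poly n"
  define T where "T = block_tree n ?k q c"
  define edge where "edge j = {n, q (j, 2)}" for j
  have T: "T \<in> spanning_trees n" unfolding T_def by (rule block_tree_spanning[OF q n])
  note keysT = keys_edge_monomial[OF finite_spanning_tree[OF T]]
  have inj: "inj_on edge {..<?k}"
  proof (rule inj_onI)
    fix i j assume ij: "i \<in> {..<?k}" "j \<in> {..<?k}" and eq: "edge i = edge j"
    have "n \<noteq> q (i, 2)" "n \<noteq> q (j, 2)"
      using placement_mem[OF q, of i 2] placement_mem[OF q, of j 2] ij by auto
    then have "q (i, 2) = q (j, 2)" using eq by (auto simp: edge_def doubleton_eq_iff)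
    then show "i = j" using placement_eq_iff[OF q, of i 2 j 2] ij by simp
  qed
  define D where "D = edge ` {..<?k}"
  have edge_T: "edge j \<in> T" if "j < ?k" for j
    unfolding edge_def T_def by (rule block_tree_edges(1)[OF q that])
  then have "D \<subseteq> T" unfolding D_def by (intro image_subsetI) simp
  have weight: "weight D a = card {j\<in>{..<?k}. edge j \<in> Poly_Mapping.keys a}" for a
  proof -
    have "D \<inter> Poly_Mapping.keys a = edge ` {j\<in>{..<?k}. edge j \<in> Poly_Mapping.keys a}"
      by (auto simp: D_def)
    moreover have "inj_on edge {j\<in>{..<?k}. edge j \<in> Poly_Mapping.keys a}"
      by (rule inj_on_subset[OF inj]) auto
    ultimately show ?thesis by (simp add: weight_def card_image)
  qed
  have "weight D (edge_monomial T) = card D"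
    using \<open>D \<subseteq> T\<close> by (simp add: weight_def keysT Int_absorb2)
  also have "card D = ?k" by (simp add: D_def card_image[OF inj])
  finally have heavy: "2 * m < weight D (edge_monomial T)" using m by simp
  have key: "edge_monomial T \<in> Poly_Mapping.keys ?f" using T by (simp add: keys_spanning_tree_poly)
  have cof: "0 \<in> cofactors ?f ?f" by (simp add: cofactors_def)
  have out: "gate_poly C (out C) ?f" "out C \<in> gates C"
    using C by (simp_all add: computes_def monotone_circuit_def)
  have "finite D" by (simp add: D_def)
  from balanced_factor[OF out(1) C(1) out(2) this m key cof heavy]
  obtain h p a b where h: "h \<in> gates C" "inputs (label C h) \<noteq> {}" "gate_poly C h p"
    and a: "a \<in> Poly_Mapping.keys p" and b: "b \<in> cofactors ?f p"
    and ab: "a + b = edge_monomial T" and wa: "m < weight D a" "weight D a \<le> 2 * m"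
    unfolding add_0_right by blast
  obtain T' where T': "T' \<in> spanning_trees n" "a + b = edge_monomial T'"
    "Poly_Mapping.keys a \<union> Poly_Mapping.keys b = T'"
    using factor_cofactor[OF a b] by metis
  have "T' = T"
    using arg_cong[OF trans[OF T'(2)[symmetric] ab], of Poly_Mapping.keys]
    unfolding keysT keys_edge_monomial[OF finite_spanning_tree[OF T'(1)]] .
  with T'(3) have keys_ab: "Poly_Mapping.keys a \<union> Poly_Mapping.keys b = T" by blast
  have sub: "Poly_Mapping.keys a \<subseteq> factor_edges p" "Poly_Mapping.keys b \<subseteq> cofactor_edges ?f p"
    using a b unfolding factor_edges_def cofactor_edges_def by blast+
  have "m \<le> card {j\<in>{..<?k}. edge j \<in> Poly_Mapping.keys a}" using wa(1) by (simp add: weight)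
  also have "\<dots> \<le> card {j\<in>{..<?k}. edge j \<in> factor_edges p}"
    using sub by (intro card_mono) auto
  finally have balR: "m \<le> card {j\<in>{..<?k}. edge j \<in> factor_edges p}" .
  have "?k = card {..<?k}" by simp
  also have "\<dots> \<le> card ({j\<in>{..<?k}. edge j \<in> Poly_Mapping.keys a} \<union> {j\<in>{..<?k}. edge j \<in> Poly_Mapping.keys b})"
    using edge_T[folded keys_ab] by (intro card_mono subsetI) simp_all
  also have "\<dots> \<le> weight D a + card {j\<in>{..<?k}. edge j \<in> Poly_Mapping.keys b}"
    unfolding weight by (rule card_Un_le)
  finally have "m \<le> card {j\<in>{..<?k}. edge j \<in> Poly_Mapping.keys b}" using wa(2) by linarith
  also have "\<dots> \<le> card {j\<in>{..<?k}. edge j \<in> cofactor_edges ?f p}"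
    using sub by (intro card_mono) auto
  finally have "balanced (factor_edges p) (cofactor_edges ?f p) n ?k m q"
    using balR by (simp add: balanced_def edge_def)
  moreover have "all_ok (factor_edges p) (cofactor_edges ?f p) n ?k q c"
    using block_tree_all_ok[OF q a b] keys_ab by (simp add: T_def)
  ultimately show thesis using that[OF h] by blast
qed

lemma placements_nonempty:
  assumes "finite V" "3 * k \<le> card V"
  shows "placements k V \<noteq> {}"
proof -
  have "card (positions k) \<le> card V" using assms by simp
  then obtain q where "inj_on q (positions k)" "q ` positions k \<subseteq> V"
    using card_le_inj[of "positions k" V] assms(1) by auto
  then have "restrict q (positions k) \<in> placements k V"
    by (auto simp: placements_def inj_on_restrict_eq)
  then show ?thesis by blast
qed

lemma circuit_size_lower_bound:
  assumes C: "monotone_circuit X C" "computes C (spanning_tree_poly n)"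
    and m: "m \<ge> 1" and n: "9 * m < n"
  shows "(9/8) ^ m \<le> 3 * real m * real (circuit_size C)"
proof -
  let ?k = "3 * m" and ?f = "spanning_tree_poly n"
  define W where "W = placements ?k {1..<n} \<times> choices ?k"
  define G where "G = {g \<in> gates C. inputs (label C g) \<noteq> {}}"
  define P where "P h = (THE p. gate_poly C h p)" for h
  define A where "A h = {(q, c)\<in>W. all_ok (factor_edges (P h)) (cofactor_edges ?f (P h)) n ?k q c \<and>
    balanced (factor_edges (P h)) (cofactor_edges ?f (P h)) n ?k m q}" for h
  have P: "P h = p" if "gate_poly C h p" for h p
    unfolding P_def using that gate_poly_unique by (intro the_equality)
  have finG: "finite G" using C(1) by (simp add: G_def monotone_circuit_def)
  have finW: "finite W" by (simp add: W_def finite_placements finite_choices)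
  have cardA: "real (card (A h)) \<le> real ?k * (8/9) ^ m * real (card W)" for h
    unfolding A_def W_def using m
    by (intro card_all_ok_balanced factor_cofactor_edges_disjoint) simp_all
  have "W \<subseteq> (\<Union>h\<in>G. A h)"
  proof
    fix w assume w: "w \<in> W"
    obtain q c where qc: "w = (q, c)" by (cases w)
    have q: "q \<in> placements ?k {1..<n}" using w by (simp add: qc W_def)
    obtain h p where h: "h \<in> gates C" "inputs (label C h) \<noteq> {}" "gate_poly C h p"
      "all_ok (factor_edges p) (cofactor_edges ?f p) n ?k q c"
      "balanced (factor_edges p) (cofactor_edges ?f p) n ?k m q"
      using placement_factorization[OF C m _ q] n by (metis gr_implies_not0 less_one linorder_not_less)
    then have "w \<in> A h" using w by (simp add: A_def qc P)
    then show "w \<in> (\<Union>h\<in>G. A h)" using h by (auto simp: G_def)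
  qed
  moreover have "finite (A h)" for h
    by (rule finite_subset[OF _ finW]) (auto simp: A_def)
  ultimately have "card W \<le> card (\<Union>h\<in>G. A h)" using finG by (intro card_mono) simp_all
  also have "\<dots> \<le> (\<Sum>h\<in>G. card (A h))" by (rule card_UN_le[OF finG])
  finally have "real (card W) \<le> (\<Sum>h\<in>G. real (card (A h)))"
    by (simp only: of_nat_sum[symmetric] of_nat_le_iff)
  also have "\<dots> \<le> (\<Sum>h\<in>G. real ?k * (8/9) ^ m * real (card W))" by (intro sum_mono cardA)
  also have "\<dots> = real (card G) * (real ?k * (8/9) ^ m) * real (card W)" by simp
  finally have "1 * real (card W) \<le> real (card G) * (real ?k * (8/9) ^ m) * real (card W)" by simp
  moreover have "0 < real (card W)"
  proof -
    have "placements ?k {1..<n} \<noteq> {}" using n by (intro placements_nonempty) auto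
    moreover have "choices ?k \<noteq> {}" by (simp add: choices_def PiE_eq_empty_iff lessThan_empty_iff)
    ultimately show ?thesis using finW by (simp add: W_def card_gt_0_iff)
  qed
  ultimately have "1 \<le> real (card G) * (real ?k * (8/9) ^ m)" by (simp only: mult_le_cancel_right_pos)
  then have "(9/8) ^ m \<le> (9/8) ^ m * (real (card G) * (real ?k * (8/9) ^ m))" by simp
  also have "\<dots> = ((9/8) * (8/9)) ^ m * (real (card G) * real ?k)"
    by (simp only: power_mult_distrib mult_ac)
  finally show ?thesis by (simp add: circuit_size_def G_def mult_ac)
qed

theorem theorem1:
  shows "\<exists>c::real. c > 0 \<and> (\<exists>n0::nat. \<forall>n\<ge>n0.
    real (monotone_complexity (complete_edges n) (spanning_tree_poly n)) \<ge> 2 powr (c * sqrt (real n)))"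
proof -
  have "\<forall>\<^sub>F n::nat in sequentially. 2 powr (1 * sqrt (real n)) * real n \<le> (9/8) powr (real n / 9 - 2)"
    by real_asymp
  then obtain n1 where n1: "\<And>n. n \<ge> n1 \<Longrightarrow>
      2 powr (1 * sqrt (real n)) * real n \<le> (9/8) powr (real n / 9 - 2)"
    unfolding eventually_sequentially by blast
  have "2 powr (1 * sqrt (real n)) \<le>
      real (monotone_complexity (complete_edges n) (spanning_tree_poly n))" if n: "n \<ge> max n1 10" for n
  proof -
    obtain C where C: "monotone_circuit (complete_edges n) C" "computes C (spanning_tree_poly n)"
      "circuit_size C = monotone_complexity (complete_edges n) (spanning_tree_poly n)"
      using monotone_complexity_attained[OF spanning_tree_poly_line_computable] .
    define m where "m = (n - 1) div 9"
    have m: "m \<ge> 1" "9 * m < n" "n \<le> 9 * m + 9"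
      using n by (auto simp: m_def)
    have "2 powr (1 * sqrt (real n)) * real n \<le> (9/8) powr (real n / 9 - 2)" using n1 n by simp
    also have "\<dots> \<le> (9/8) powr real m" using m(3) by (intro powr_mono) linarith+
    also have "\<dots> = (9/8) ^ m" by (simp add: powr_realpow)
    also have "\<dots> \<le> 3 * real m * real (circuit_size C)"
      by (rule circuit_size_lower_bound[OF C(1,2) m(1,2)])
    also have "\<dots> \<le> real n * real (circuit_size C)"
      using m by (intro mult_right_mono) linarith+
    finally have "2 powr (1 * sqrt (real n)) * real n \<le> real (circuit_size C) * real n"
      by (simp only: mult.commute)
    then show ?thesis using n by (simp only: C(3)) (simp add: mult_le_cancel_right)
  qed
  then show ?thesis by (intro exI[of _ 1] conjI exI[of _ "max n1 10"] allI impI) simp_all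
qed

end
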